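(* In the streaming PCA setting, consider the Krasulina–Oja iterates and $L_t:=\sin^2(\hat{\bm v}_t,\bm v_1)$. Let $\delta\in(0,1)$ and suppose $\mathbb P(L_0\le1/4)\ge1-\delta^3$. Define $L:=\max\{\lceil128B^4\log(\delta^{-1})^2/\rho^2\rceil;32\}$ and choose the step sizes $\eta_t=\frac{2}{\rho(t+L)}$. Then with probability at least $1-2(e+1)\delta$, uniformly over all $t\ge0$, $$L_t\le\max\Big\{\frac{252L}{\log(\delta^{-1})};\frac{1008B^4}{\rho^2}\Big\}\cdot\frac{\log(\delta^{-1})+2\log\log(t+9)}{t+L}.$$
   Context: Streaming PCA setting: $\bm X_1,\bm X_2,\dots\in\mathbb R^p$ are i.i.d. centered random vectors with covariance matrix $\bm\Sigma$, and $\|\bm X_i\|\le B$ almost surely. The eigenvalues of $\bm\Sigma$ in decreasing order are $\lambda_1>\lambda_2\ge\dots\ge\lambda_p$, $\bm v_1$ is a unit eigenvector for $\lambda_1$, and $\rho:=\lambda_1-\lambda_2$ is the eigengap. $\hat{\bm v}_0$ is a random unit vector independent of $(\bm X_t)$. $\{\eta_t\}_{t\ge1}$ are deterministic positive step sizes. Krasulina–Oja update: with $y_t:=\bm X_t^\top\hat{\bm v}_{t-1}$, $\hat{\bm v}_t=\hat{\bm v}_{t-1}+\eta_t\,y_t\big[\bm X_t-\frac{y_t}{\|\hat{\bm v}_{t-1}\|^2}\hat{\bm v}_{t-1}\big]$. For non-zero $\bm x,\bm y$, $\sin^2(\bm x,\bm y):=1-\frac{\langle\bm x,\bm y\rangle^2}{\|\bm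 x\|^2\|\bm y\|^2}$. $\mathcal F_t:=\sigma(\hat{\bm v}_0,\bm X_1,\dots,\bm X_t)$. *)

theory Defs
  imports "HOL-Probability.Probability"
begin

definition eigvals :: "real^'n^'n \<Rightarrow> real set" where
  "eigvals A = {\<mu>. \<exists>x. x \<noteq> 0 \<and> A *v x = \<mu> *\<^sub>R x}"

definition eigspace :: "real^'n^'n \<Rightarrow> real \<Rightarrow> (real^'n) set" where
  "eigspace A \<mu> = {x. A *v x = \<mu> *\<^sub>R x}"

definition lambda1 :: "real^'n^'n \<Rightarrow> real" where
  "lambda1 A = Max (eigvals A)"

text \<open>Second largest eigenvalue lambda_2 in the list of eigenvalues in decreasing order,
  counted with multiplicity (for symmetric A geometric = algebraic multiplicity):
  if lambda_1 has multiplicity at least 2 then lambda_2 = lambda_1.\<close>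
definition lambda2 :: "real^'n^'n \<Rightarrow> real" where
  "lambda2 A = (if dim (eigspace A (lambda1 A)) \<ge> 2 then lambda1 A
                else Max (eigvals A - {lambda1 A}))"

text \<open>Covariance matrix of a centered random vector Y: entries E[Y_i Y_j].\<close>
definition cov_matrix :: "'a measure \<Rightarrow> ('a \<Rightarrow> real^'n) \<Rightarrow> real^'n^'n" where
  "cov_matrix M Y = (\<chi> i j. integral\<^sup>L M (\<lambda>\<omega>. Y \<omega> $ i * Y \<omega> $ j))"

definition sin2 :: "real^'n \<Rightarrow> real^'n \<Rightarrow> real" where
  "sin2 x y = 1 - (x \<bullet> y)^2 / ((norm x)^2 * (norm y)^2)"

text \<open>Krasulina--Oja iterates along a sample path: step sizes eta, data xs (xs t = X_t, t \<ge> 1),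
  initial vector v0.\<close>
fun kooja :: "(nat \<Rightarrow> real) \<Rightarrow> (nat \<Rightarrow> real^'n) \<Rightarrow> real^'n \<Rightarrow> nat \<Rightarrow> real^'n" where
  "kooja eta xs v0 0 = v0"
| "kooja eta xs v0 (Suc t) =
     (let v = kooja eta xs v0 t; x = xs (Suc t); y = x \<bullet> v
      in v + (eta (Suc t) * y) *\<^sub>R (x - (y / (norm v)^2) *\<^sub>R v))"

end

theory Submission
  imports Defs
begin

text \<open>
  Write r = t + L and b = B^4 / \<rho>^2 for the eigengap \<rho>. One update with step size h obeys, pathwise,
  sin2 (oja_step h x v) v1 \<le> sin2 v v1 - h Z + h^2 B^4 / 4, where the drift Z is bounded by
  B^2 sqrt (sin2 v v1). The eigengap gives Z a mean of at least \<rho> (sin2 v v1) as long as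
  sin2 v v1 \<le> 1/2, so by Hoeffding's lemma the exponential moment of \<theta> sin2 after the step h = 2 / (\<rho> r)
  is governed by the factor 1 - 2/r + 2 \<theta> b / r^2 on sin2 v v1. For a horizon H the weights
  \<theta>(r) = r sqrt (r/H) / (4b) therefore turn exp (\<theta>(r) sin2 - sqrt (r/H) / 2) into a supermartingale
  while sin2 \<le> 1/2 and r \<le> H; the exponent 3/2 > 1 of r keeps the accumulated variance bounded
  instead of logarithmic in t. Ville's inequality at the horizons H = 4^(k+1) L with failure
  probabilities \<delta> / (k+1)^2 yields the iterated-logarithm rate. If no level is crossed up to and
  including time t, then sin2 \<le> 1/2 at time t, so the localization to sin2 \<le> 1/2 costs nothing.
\<close>

subsection \<open>Self-adjoint operators and the eigengap\<close>

definition selfadjoint :: "('a::real_inner \<Rightarrow> 'a) \<Rightarrow> bool" where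
  "selfadjoint f \<longleftrightarrow> linear f \<and> (\<forall>x y. f x \<bullet> y = x \<bullet> f y)"

lemma selfadjoint_matrix_vector_mul:
  fixes A :: "real^'n^'n"
  assumes "transpose A = A"
  shows "selfadjoint ((*v) A)"
  using assms unfolding selfadjoint_def
  by (metis dot_lmul_matrix matrix_vector_mul_linear transpose_matrix_vector)

lemma linear_coefficient_eq_0_if_quadratic_nonneg:
  fixes a b :: real
  assumes "\<And>t. 0 \<le> a * t + b * t^2"
  shows "a = 0"
proof (rule DERIV_local_min[where d = 1])
  show "((\<lambda>t. a * t + b * t^2) has_real_derivative a) (at 0)"
    by (auto intro!: derivative_eq_intros)
qed (use assms in auto)

lemma rayleigh_maximizer_imp_eigenvector:
  fixes f :: "'a::real_inner \<Rightarrow> 'a"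
  assumes f: "selfadjoint f"
    and S: "subspace S" "f ` S \<subseteq> S"
    and w: "w \<in> S" "w \<bullet> f w = \<mu> * (w \<bullet> w)"
    and max: "\<And>x. x \<in> S \<Longrightarrow> x \<bullet> f x \<le> \<mu> * (x \<bullet> x)"
  shows "f w = \<mu> *\<^sub>R w"
proof -
  interpret linear f using f by (simp add: selfadjoint_def)
  have sym: "f x \<bullet> y = x \<bullet> f y" for x y using f by (simp add: selfadjoint_def)
  define r where "r = \<mu> *\<^sub>R w - f w"
  have "r \<in> S" using S w by (auto simp: r_def intro!: subspace_diff subspace_scale)
  have "0 \<le> 2 * (r \<bullet> r) * t + (\<mu> * (r \<bullet> r) - r \<bullet> f r) * t^2" for t
  proof -
    have "w + t *\<^sub>R r \<in> S" using S w \<open>r \<in> S\<close> by (auto intro!: subspace_add subspace_scale)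
    then have "0 \<le> \<mu> * ((w + t *\<^sub>R r) \<bullet> (w + t *\<^sub>R r)) - (w + t *\<^sub>R r) \<bullet> f (w + t *\<^sub>R r)"
      using max by simp
    also have "\<dots> = 2 * (\<mu> * (w \<bullet> r) - f w \<bullet> r) * t + (\<mu> * (r \<bullet> r) - r \<bullet> f r) * t^2"
      using w(2) sym[of r w] sym[of w r]
      by (simp add: add scale power2_eq_square inner_commute algebra_simps)
    also have "\<mu> * (w \<bullet> r) - f w \<bullet> r = r \<bullet> r"
      by (subst (3) r_def) (simp add: inner_diff)
    finally show ?thesis .
  qed
  then have "r \<bullet> r = 0"
    using linear_coefficient_eq_0_if_quadratic_nonneg by fastforce
  then show ?thesis by (simp add: r_def)
qed

lemma invariant_subspace_max_eigenvector:
  fixes f :: "'a::euclidean_space \<Rightarrow> 'a"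
  assumes f: "selfadjoint f"
    and S: "subspace S" "f ` S \<subseteq> S" "\<exists>x\<in>S. x \<noteq> 0"
  obtains \<mu> w where "w \<in> S" "w \<noteq> 0" "f w = \<mu> *\<^sub>R w" "\<And>x. x \<in> S \<Longrightarrow> x \<bullet> f x \<le> \<mu> * (x \<bullet> x)"
proof -
  interpret linear f using f by (simp add: selfadjoint_def)
  let ?C = "S \<inter> sphere 0 1"
  have normalized: "x /\<^sub>R norm x \<in> ?C" if "x \<in> S" "x \<noteq> 0" for x
    using that S(1) by (auto simp: subspace_scale)
  have "compact ?C" using closed_subspace[OF S(1)] by (simp add: closed_Int_compact)
  moreover have "?C \<noteq> {}" using S(3) normalized by blast
  moreover have "continuous_on ?C (\<lambda>x. x \<bullet> f x)"
    by (intro continuous_intros linear_continuous_on linear_conv_bounded_linear[THEN iffD1])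
      unfold_locales
  ultimately obtain w where w: "w \<in> ?C" and w_max: "\<And>x. x \<in> ?C \<Longrightarrow> x \<bullet> f x \<le> w \<bullet> f w"
    using continuous_attains_sup[of ?C "\<lambda>x. x \<bullet> f x"] by blast
  define \<mu> where "\<mu> = w \<bullet> f w"
  have max: "x \<bullet> f x \<le> \<mu> * (x \<bullet> x)" if "x \<in> S" for x
  proof (cases "x = 0")
    case False
    have "(x /\<^sub>R norm x) \<bullet> f (x /\<^sub>R norm x) = x \<bullet> f x / (x \<bullet> x)"
      by (simp add: scale dot_square_norm power2_eq_square field_simps)
    with w_max[OF normalized[OF that False]] False show ?thesis
      by (simp add: \<mu>_def pos_divide_le_eq)
  qed simp
  have "w \<bullet> w = 1" using w by (simp add: norm_eq_1)
  then have "f w = \<mu> *\<^sub>R w"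
    using w by (intro rayleigh_maximizer_imp_eigenvector[OF f S(1,2) _ _ max]) (auto simp: \<mu>_def)
  with w max show thesis by (intro that[of w \<mu>]) auto
qed

lemma finite_eigvals_symmetric:
  fixes A :: "real^'n^'n"
  assumes "transpose A = A"
  shows "finite (eigvals A)"
proof -
  have "\<forall>\<mu>\<in>eigvals A. \<exists>x. x \<noteq> 0 \<and> A *v x = \<mu> *\<^sub>R x" by (auto simp: eigvals_def)
  then obtain eigvec
    where eigvec: "\<And>\<mu>. \<mu> \<in> eigvals A \<Longrightarrow> eigvec \<mu> \<noteq> 0 \<and> A *v eigvec \<mu> = \<mu> *\<^sub>R eigvec \<mu>"
    by metis
  have orth: "eigvec \<mu> \<bullet> eigvec \<nu> = 0" if "\<mu> \<in> eigvals A" "\<nu> \<in> eigvals A" "\<mu> \<noteq> \<nu>" for \<mu> \<nu>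
  proof -
    have "(A *v eigvec \<mu>) \<bullet> eigvec \<nu> = eigvec \<mu> \<bullet> (A *v eigvec \<nu>)"
      using selfadjoint_matrix_vector_mul[OF assms] by (simp add: selfadjoint_def)
    then show ?thesis using eigvec that by simp
  qed
  have "inj_on eigvec (eigvals A)"
    by (rule inj_onI, rule ccontr) (use orth eigvec in force)
  moreover have "pairwise orthogonal (eigvec ` eigvals A)"
    using orth by (auto simp: pairwise_def orthogonal_def)
  then have "independent (eigvec ` eigvals A)"
    using eigvec by (intro pairwise_orthogonal_independent) auto
  ultimately show ?thesis
    using finite_imageD independent_bound by blast
qed

definition eigengap :: "real^'n^'n \<Rightarrow> real" where
  "eigengap A = lambda1 A - lambda2 A"

lemma eigenvalue_le_lambda2:
  fixes A :: "real^'n^'n"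
  assumes sym: "transpose A = A" and gap: "0 < eigengap A"
    and v: "v \<noteq> 0" "A *v v = lambda1 A *\<^sub>R v"
    and w: "w \<noteq> 0" "A *v w = \<mu> *\<^sub>R w" "w \<bullet> v = 0"
  shows "\<mu> \<le> lambda2 A"
proof -
  have simple: "dim (eigspace A (lambda1 A)) < 2"
    using gap by (auto simp: eigengap_def lambda2_def split: if_splits)
  have "\<mu> \<noteq> lambda1 A"
  proof
    assume "\<mu> = lambda1 A"
    then have "{v, w} \<subseteq> eigspace A (lambda1 A)" using v w by (auto simp: eigspace_def)
    moreover have "pairwise orthogonal {v, w}"
      using w(3) by (auto simp: pairwise_def orthogonal_def inner_commute)
    then have "independent {v, w}"
      using v(1) w(1) by (intro pairwise_orthogonal_independent) auto
    moreover have "v \<noteq> w" using v(1) w(3) by auto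
    then have "card {v, w} = 2" by simp
    ultimately show False
      using simple by (metis independent_card_le_dim not_le)
  qed
  moreover have "\<mu> \<in> eigvals A" using w by (auto simp: eigvals_def)
  ultimately show ?thesis
    using simple finite_eigvals_symmetric[OF sym] by (simp add: lambda2_def)
qed

lemma quadratic_form_le_lambda2:
  fixes A :: "real^'n^'n"
  assumes sym: "transpose A = A" and gap: "0 < eigengap A"
    and v: "v \<noteq> 0" "A *v v = lambda1 A *\<^sub>R v"
    and x: "x \<bullet> v = 0"
  shows "x \<bullet> (A *v x) \<le> lambda2 A * (x \<bullet> x)"
proof (cases "x = 0")
  case False
  note A = selfadjoint_matrix_vector_mul[OF sym]
  define S where "S = {x. x \<bullet> v = 0}"
  have "subspace S" by (auto simp: S_def subspace_def inner_add_left)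
  moreover have "(A *v y) \<bullet> v = y \<bullet> (lambda1 A *\<^sub>R v)" for y
    using A v(2) by (metis selfadjoint_def)
  then have "(*v) A ` S \<subseteq> S" by (auto simp: S_def)
  moreover have "\<exists>x\<in>S. x \<noteq> 0" using False x by (auto simp: S_def)
  ultimately obtain \<mu> w where w: "w \<in> S" "w \<noteq> 0" "A *v w = \<mu> *\<^sub>R w"
    and max: "\<And>x. x \<in> S \<Longrightarrow> x \<bullet> (A *v x) \<le> \<mu> * (x \<bullet> x)"
    using invariant_subspace_max_eigenvector[OF A] by metis
  have "x \<bullet> (A *v x) \<le> \<mu> * (x \<bullet> x)" using max x by (simp add: S_def)
  also have "\<mu> \<le> lambda2 A"
    using w by (intro eigenvalue_le_lambda2[OF sym gap v]) (auto simp: S_def)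
  then have "\<mu> * (x \<bullet> x) \<le> lambda2 A * (x \<bullet> x)" by (simp add: mult_right_mono)
  finally show ?thesis .
qed simp

definition orth_residual :: "'a::real_inner \<Rightarrow> 'a \<Rightarrow> 'a" where
  "orth_residual u x = x - (x \<bullet> u) *\<^sub>R u"

lemma inner_orth_residual_left:
  assumes "norm u = 1"
  shows "orth_residual u x \<bullet> u = 0"
  using assms by (simp add: orth_residual_def inner_diff norm_eq_1)

lemma norm_orth_residual:
  assumes "norm u = 1"
  shows "(norm (orth_residual u x))^2 = (norm x)^2 - (x \<bullet> u)^2"
proof -
  have "(norm x)^2 = (norm (orth_residual u x + (x \<bullet> u) *\<^sub>R u))^2" by (simp add: orth_residual_def)
  also have "\<dots> = (norm (orth_residual u x))^2 + (norm ((x \<bullet> u) *\<^sub>R u))^2"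
    by (rule norm_add_Pythagorean)
       (simp add: orthogonal_def inner_orth_residual_left[OF assms])
  finally show ?thesis using assms by simp
qed

lemma eigengap_mult_le:
  fixes A :: "real^'n^'n"
  assumes sym: "transpose A = A" and gap: "0 < eigengap A"
    and v: "norm v = 1" "A *v v = lambda1 A *\<^sub>R v" and u: "norm u = 1"
  shows "eigengap A * (1 - (u \<bullet> v)^2) \<le> lambda1 A - u \<bullet> (A *v u)"
proof -
  let ?c = "u \<bullet> v" and ?w = "orth_residual v u"
  have A: "(A *v x) \<bullet> y = x \<bullet> (A *v y)" for x y
    using selfadjoint_matrix_vector_mul[OF sym] by (simp add: selfadjoint_def)
  have w: "?w \<bullet> v = 0" "?w \<bullet> ?w = 1 - ?c^2"
    using inner_orth_residual_left[OF v(1)] norm_orth_residual[OF v(1), of u] u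
    by (simp_all add: power2_norm_eq_inner)
  have "v \<bullet> (A *v ?w) = 0" using A[of v ?w] v(2) w(1) by (simp add: inner_commute)
  moreover have u_eq: "u = ?c *\<^sub>R v + ?w" by (simp add: orth_residual_def)
  have "u \<bullet> (A *v u) = (?c *\<^sub>R v + ?w) \<bullet> (A *v (?c *\<^sub>R v + ?w))" by (simp flip: u_eq)
  ultimately have "u \<bullet> (A *v u) = ?c^2 * lambda1 A + ?w \<bullet> (A *v ?w)"
    using w(1) v by (simp add: matrix_vector_right_distrib matrix_vector_mult_scaleR inner_add
        power2_eq_square norm_eq_1)
  also have "\<dots> \<le> ?c^2 * lambda1 A + lambda2 A * (1 - ?c^2)"
    using quadratic_form_le_lambda2[OF sym gap _ v(2) w(1)] v(1) w(2) by force
  finally show ?thesis by (simp add: eigengap_def algebra_simps)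
qed

subsection \<open>One Krasulina--Oja step\<close>

definition oja_step :: "real \<Rightarrow> real^'n \<Rightarrow> real^'n \<Rightarrow> real^'n" where
  "oja_step h x v = v + (h * (x \<bullet> v)) *\<^sub>R (x - ((x \<bullet> v) / (norm v)^2) *\<^sub>R v)"

lemma kooja_Suc: "kooja eta xs v (Suc t) = oja_step (eta (Suc t)) (xs (Suc t)) (kooja eta xs v t)"
  by (simp add: oja_step_def Let_def)

lemma oja_step_scaleR: "oja_step h x (k *\<^sub>R v) = k *\<^sub>R oja_step h x v"
  by (cases "k = 0") (simp_all add: oja_step_def scaleR_add_right scaleR_diff_right
      power_mult_distrib power2_eq_square[of k] mult_ac)

lemma oja_step_unit:
  assumes "norm u = 1"
  shows "oja_step h x u = u + (h * (x \<bullet> u)) *\<^sub>R orth_residual u x"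
  using assms by (simp add: oja_step_def orth_residual_def)

lemma sin2_nonneg: "0 \<le> sin2 x y"
proof -
  have "(x \<bullet> y)^2 \<le> (norm x)^2 * (norm y)^2"
    using Cauchy_Schwarz_ineq[of x y] by (simp add: power2_norm_eq_inner)
  then show ?thesis
    by (auto simp: sin2_def divide_le_eq_1 not_less simp flip: power_mult_distrib)
qed

lemma sin2_scaleR: "k \<noteq> 0 \<Longrightarrow> sin2 (k *\<^sub>R x) y = sin2 x y"
  by (simp add: sin2_def power_mult_distrib)

lemma sin2_sgn: "v \<noteq> 0 \<Longrightarrow> sin2 (sgn v) y = sin2 v y"
  by (simp add: sgn_div_norm sin2_scaleR)

lemma sin2_oja_step_sgn: "v \<noteq> 0 \<Longrightarrow> sin2 (oja_step h x (sgn v)) y = sin2 (oja_step h x v) y"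
  by (simp add: sgn_div_norm oja_step_scaleR sin2_scaleR)

lemma sin2_unit: "norm u = 1 \<Longrightarrow> norm v = 1 \<Longrightarrow> sin2 u v = 1 - (u \<bullet> v)^2"
  by (simp add: sin2_def)

lemma sin2_add_orthogonal_le:
  assumes unit: "norm u = 1" "norm v = 1" and orth: "d \<bullet> u = 0"
  shows "sin2 (u + d) v \<le> 1 - (u \<bullet> v)^2 - 2 * (u \<bullet> v) * (d \<bullet> v) + (norm d)^2"
proof -
  let ?c = "u \<bullet> v" and ?a = "d \<bullet> v" and ?s = "(norm d)^2"
  have norm_sum: "(norm (u + d))^2 = 1 + ?s"
    using unit orth norm_add_Pythagorean[of u d] by (simp add: orthogonal_def inner_commute)
  have "(?c + ?a)^2 \<le> 1 + ?s"
    using Cauchy_Schwarz_ineq[of "u + d" v] unit norm_sum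
    by (simp add: inner_add_left flip: power2_norm_eq_inner)
  then have "0 \<le> 1 + ?s - (?c + ?a)^2 + ?a^2" by simp
  also have "\<dots> = 1 + ?s - ?c^2 - 2 * ?c * ?a" by (simp add: power2_eq_square algebra_simps)
  finally have "0 \<le> ?s * (1 + ?s - ?c^2 - 2 * ?c * ?a) + ?a^2" by simp
  moreover have "0 < 1 + ?s" by (simp add: add_pos_nonneg)
  ultimately have "1 - (?c + ?a)^2 / (1 + ?s) \<le> 1 - ?c^2 - 2 * ?c * ?a + ?s"
    by (simp add: field_simps power2_eq_square)
  then show ?thesis
    using unit by (simp add: sin2_def norm_sum inner_add_left)
qed

lemma abs_inner_mult_norm_orth_residual_le:
  assumes "norm u = 1"
  shows "\<bar>x \<bullet> u\<bar> * norm (orth_residual u x) \<le> (norm x)^2 / 2"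
  using norm_orth_residual[OF assms, of x] zero_le_power2[of "\<bar>x \<bullet> u\<bar> - norm (orth_residual u x)"]
  by (simp add: power2_diff)

definition oja_drift :: "real^'n \<Rightarrow> real^'n \<Rightarrow> real^'n \<Rightarrow> real" where
  "oja_drift u v x = 2 * (u \<bullet> v) * (x \<bullet> u) * (orth_residual u x \<bullet> v)"

lemma sin2_oja_step_le:
  assumes v: "v \<noteq> 0" and w: "norm w = 1"
  shows "sin2 (oja_step h x v) w \<le> sin2 v w - h * oja_drift (sgn v) w x + h^2 * (norm x)^4 / 4"
proof -
  define u where "u = sgn v"
  have u: "norm u = 1" using v by (simp add: u_def norm_sgn)
  let ?p = "orth_residual u x"
  let ?d = "(h * (x \<bullet> u)) *\<^sub>R ?p"
  have "(norm ?d)^2 = h^2 * (\<bar>x \<bullet> u\<bar> * norm ?p)^2" by (simp add: power_mult_distrib)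
  also have "\<dots> \<le> h^2 * ((norm x)^2 / 2)^2"
    using abs_inner_mult_norm_orth_residual_le[OF u, of x]
    by (intro mult_left_mono power_mono) auto
  finally have "(norm ?d)^2 \<le> h^2 * (norm x)^4 / 4" by (simp add: power_divide)
  moreover have "sin2 (oja_step h x u) w
      \<le> 1 - (u \<bullet> w)^2 - 2 * (u \<bullet> w) * (?d \<bullet> w) + (norm ?d)^2"
    unfolding oja_step_unit[OF u]
    by (rule sin2_add_orthogonal_le[OF u w]) (simp add: inner_orth_residual_left[OF u])
  ultimately have "sin2 (oja_step h x u) w \<le> sin2 u w - h * oja_drift u w x + h^2 * (norm x)^4 / 4"
    by (simp add: sin2_unit[OF u w] oja_drift_def mult_ac)
  then show ?thesis using v by (simp add: u_def sin2_sgn sin2_oja_step_sgn)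
qed

lemma abs_oja_drift_le:
  assumes unit: "norm u = 1" "norm v = 1"
  shows "\<bar>oja_drift u v x\<bar> \<le> sqrt (sin2 u v) * (norm x)^2"
proof -
  let ?p = "orth_residual u x" and ?r = "orth_residual u v"
  have "?p \<bullet> v = ?p \<bullet> ?r"
    using inner_orth_residual_left[OF unit(1)]
    by (simp add: orth_residual_def[of u v] inner_diff_right)
  then have "\<bar>?p \<bullet> v\<bar> \<le> norm ?p * norm ?r" by (simp add: Cauchy_Schwarz_ineq2)
  moreover have "norm ?r = sqrt (sin2 u v)"
    using norm_orth_residual[OF unit(1), of v] unit
    by (simp add: sin2_unit inner_commute real_sqrt_unique)
  moreover have "\<bar>u \<bullet> v\<bar> \<le> 1" using Cauchy_Schwarz_ineq2[of u v] unit by simp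
  ultimately have "\<bar>u \<bullet> v\<bar> * (\<bar>x \<bullet> u\<bar> * \<bar>?p \<bullet> v\<bar>) \<le> 1 * (\<bar>x \<bullet> u\<bar> * (norm ?p * sqrt (sin2 u v)))"
    by (intro mult_mono mult_left_mono) auto
  also have "\<dots> = sqrt (sin2 u v) * (\<bar>x \<bullet> u\<bar> * norm ?p)" by simp
  also have "\<dots> \<le> sqrt (sin2 u v) * ((norm x)^2 / 2)"
    by (intro mult_left_mono abs_inner_mult_norm_orth_residual_le[OF unit(1)])
       (simp add: sin2_nonneg)
  finally show ?thesis by (simp add: oja_drift_def abs_mult mult.assoc)
qed

lemma borel_measurable_oja_step[measurable]:
  assumes [measurable]: "f \<in> borel_measurable M" "g \<in> borel_measurable M"
  shows "(\<lambda>\<omega>. oja_step h (f \<omega>) (g \<omega>)) \<in> borel_measurable M"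
  unfolding oja_step_def by measurable

lemma borel_measurable_sin2[measurable]:
  assumes [measurable]: "f \<in> borel_measurable M" "g \<in> borel_measurable M"
  shows "(\<lambda>\<omega>. sin2 (f \<omega>) (g \<omega>)) \<in> borel_measurable M"
  unfolding sin2_def by measurable

subsection \<open>Moments of a bounded random vector\<close>

lemma transpose_cov_matrix: "transpose (cov_matrix M Y) = cov_matrix M Y"
  by (simp add: cov_matrix_def transpose_def vec_eq_iff mult.commute)

lemma cov_matrix_cong_distr:
  fixes Y Z :: "'a \<Rightarrow> real^'n"
  assumes [measurable]: "Y \<in> borel_measurable M" "Z \<in> borel_measurable M"
    and "distr M borel Y = distr M borel Z"
  shows "cov_matrix M Y = cov_matrix M Z"
proof -
  have "cov_matrix M W = cov_matrix (distr M borel W) (\<lambda>x. x)"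
    if "W \<in> borel_measurable M" for W :: "'a \<Rightarrow> real^'n"
    using that unfolding cov_matrix_def by (simp add: integral_distr)
  then show ?thesis using assms by metis
qed

locale bounded_random_vector = prob_space M for M :: "'a measure" +
  fixes Y :: "'a \<Rightarrow> real^'n" and B :: real
  assumes random_vector[measurable]: "Y \<in> borel_measurable M"
    and AE_norm_le: "AE \<omega> in M. norm (Y \<omega>) \<le> B"
begin

lemma bound_nonneg: "0 \<le> B"
proof -
  have "AE \<omega> in M. 0 \<le> B"
    using AE_norm_le by eventually_elim (meson norm_ge_zero order_trans)
  then show ?thesis by simp
qed

lemma integrable_inner_mult: "integrable M (\<lambda>\<omega>. (Y \<omega> \<bullet> u) * (Y \<omega> \<bullet> w))"
proof (rule integrable_const_bound)
  show "AE \<omega> in M. norm ((Y \<omega> \<bullet> u) * (Y \<omega> \<bullet> w)) \<le> (B * norm u) * (B * norm w)"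
    using AE_norm_le
  proof eventually_elim
    case (elim \<omega>)
    have "\<bar>Y \<omega> \<bullet> z\<bar> \<le> B * norm z" for z
      using Cauchy_Schwarz_ineq2[of "Y \<omega>" z] mult_right_mono[OF elim norm_ge_zero[of z]] by linarith
    then show ?case
      using bound_nonneg by (auto simp: abs_mult intro!: mult_mono)
  qed
qed measurable

lemma expectation_inner_mult:
  "expectation (\<lambda>\<omega>. (Y \<omega> \<bullet> u) * (Y \<omega> \<bullet> w)) = u \<bullet> (cov_matrix M Y *v w)"
proof -
  have integrable_nth: "integrable M (\<lambda>\<omega>. Y \<omega> $ i * Y \<omega> $ j)" for i j
    using integrable_inner_mult[of "axis i 1" "axis j 1"] by (simp add: inner_axis)
  have "expectation (\<lambda>\<omega>. (Y \<omega> \<bullet> u) * (Y \<omega> \<bullet> w))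
      = expectation (\<lambda>\<omega>. \<Sum>i\<in>UNIV. \<Sum>j\<in>UNIV. u $ i * w $ j * (Y \<omega> $ i * Y \<omega> $ j))"
    by (intro Bochner_Integration.integral_cong) (auto simp: inner_vec_def sum_product mult_ac)
  also have "\<dots> = (\<Sum>i\<in>UNIV. \<Sum>j\<in>UNIV. u $ i * w $ j * expectation (\<lambda>\<omega>. Y \<omega> $ i * Y \<omega> $ j))"
    using integrable_nth by (simp add: integrable_sum)
  also have "\<dots> = u \<bullet> (cov_matrix M Y *v w)"
    by (simp add: inner_vec_def cov_matrix_def matrix_vector_mult_def sum_distrib_left mult_ac)
  finally show ?thesis .
qed

end

locale eigengap_random_vector = bounded_random_vector M Y B
  for M :: "'a measure" and Y :: "'a \<Rightarrow> real^'n" and B +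
  fixes v1 :: "real^'n"
  assumes eigengap_pos: "0 < eigengap (cov_matrix M Y)"
    and norm_v1: "norm v1 = 1"
    and eigenvector_v1: "cov_matrix M Y *v v1 = lambda1 (cov_matrix M Y) *\<^sub>R v1"
begin

abbreviation "\<Sigma> \<equiv> cov_matrix M Y"

lemma eigengap_le_bound:
  assumes "2 \<le> CARD('n)"
  shows "eigengap \<Sigma> \<le> B^2"
proof -
  obtain z :: "real^'n" where "z \<noteq> 0" "orthogonal v1 z"
    by (rule orthogonal_to_vector_exists[of v1]) (use assms in simp)
  then have "norm (sgn z) = 1" "sgn z \<bullet> v1 = 0"
    by (simp_all add: norm_sgn sgn_div_norm orthogonal_def inner_commute)
  then have "eigengap \<Sigma> \<le> lambda1 \<Sigma> - sgn z \<bullet> (\<Sigma> *v sgn z)"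
    using eigengap_mult_le[OF transpose_cov_matrix eigengap_pos norm_v1 eigenvector_v1, of "sgn z"]
    by simp
  also have "0 \<le> sgn z \<bullet> (\<Sigma> *v sgn z)"
    unfolding expectation_inner_mult[symmetric] by simp
  then have "lambda1 \<Sigma> - sgn z \<bullet> (\<Sigma> *v sgn z) \<le> v1 \<bullet> (\<Sigma> *v v1)"
    using norm_v1 by (simp add: eigenvector_v1 norm_eq_1)
  also have "\<dots> = expectation (\<lambda>\<omega>. (Y \<omega> \<bullet> v1) * (Y \<omega> \<bullet> v1))"
    by (rule expectation_inner_mult[symmetric])
  also have "\<dots> \<le> expectation (\<lambda>_. B^2)"
  proof (rule integral_mono_AE[OF integrable_inner_mult])
    show "AE \<omega> in M. (Y \<omega> \<bullet> v1) * (Y \<omega> \<bullet> v1) \<le> B^2"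
      using AE_norm_le
    proof eventually_elim
      case (elim \<omega>)
      then have "\<bar>Y \<omega> \<bullet> v1\<bar> \<le> B" using Cauchy_Schwarz_ineq2[of "Y \<omega>" v1] norm_v1 by simp
      then show ?case using abs_le_square_iff[of "Y \<omega> \<bullet> v1" B] by (simp add: power2_eq_square)
    qed
  qed simp
  finally show ?thesis by (simp add: prob_space)
qed

lemma expectation_oja_drift:
  "expectation (\<lambda>\<omega>. oja_drift u v1 (Y \<omega>)) = 2 * (u \<bullet> v1)^2 * (lambda1 \<Sigma> - u \<bullet> (\<Sigma> *v u))"
proof -
  let ?c = "u \<bullet> v1"
  have "(\<lambda>\<omega>. oja_drift u v1 (Y \<omega>))
      = (\<lambda>\<omega>. 2 * ?c * ((Y \<omega> \<bullet> u) * (Y \<omega> \<bullet> v1)) - 2 * ?c^2 * ((Y \<omega> \<bullet> u) * (Y \<omega> \<bullet> u)))"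
    by (simp add: oja_drift_def orth_residual_def power2_eq_square fun_eq_iff algebra_simps)
  then have "expectation (\<lambda>\<omega>. oja_drift u v1 (Y \<omega>))
      = 2 * ?c * (u \<bullet> (\<Sigma> *v v1)) - 2 * ?c^2 * (u \<bullet> (\<Sigma> *v u))"
    by (simp add: integrable_inner_mult expectation_inner_mult)
  then show ?thesis
    by (simp add: eigenvector_v1 power2_eq_square algebra_simps)
qed

lemma expectation_oja_drift_ge:
  assumes u: "norm u = 1" and half: "sin2 u v1 \<le> 1/2"
  shows "eigengap \<Sigma> * sin2 u v1 \<le> expectation (\<lambda>\<omega>. oja_drift u v1 (Y \<omega>))"
proof -
  note sin2 = sin2_unit[OF u norm_v1]
  have "eigengap \<Sigma> * sin2 u v1 \<le> lambda1 \<Sigma> - u \<bullet> (\<Sigma> *v u)"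
    unfolding sin2
    by (rule eigengap_mult_le[OF transpose_cov_matrix eigengap_pos norm_v1 eigenvector_v1 u])
  moreover have "0 \<le> eigengap \<Sigma> * sin2 u v1" using eigengap_pos by (simp add: sin2_nonneg)
  moreover have "1 \<le> 2 * (u \<bullet> v1)^2" using half by (simp add: sin2)
  ultimately have "1 * (eigengap \<Sigma> * sin2 u v1) \<le> 2 * (u \<bullet> v1)^2 * (lambda1 \<Sigma> - u \<bullet> (\<Sigma> *v u))"
    by (intro mult_mono) auto
  then show ?thesis by (simp add: expectation_oja_drift)
qed

lemma exp_moment_oja_drift_le:
  assumes u: "norm u = 1" and half: "sin2 u v1 \<le> 1/2" and "0 < l"
  shows "(\<integral>\<^sup>+\<omega>. exp (- (l * oja_drift u v1 (Y \<omega>))) \<partial>M)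
    \<le> exp (- (l * eigengap \<Sigma> * sin2 u v1) + l^2 * sin2 u v1 * B^4 / 2)"
proof -
  define f where "f \<omega> = - oja_drift u v1 (Y \<omega>)" for \<omega>
  let ?R = "sqrt (sin2 u v1) * B^2"
  have [measurable]: "f \<in> borel_measurable M"
    unfolding f_def oja_drift_def orth_residual_def by measurable
  have "AE \<omega> in M. f \<omega> \<in> {- ?R..?R}"
    using AE_norm_le
  proof eventually_elim
    case (elim \<omega>)
    have "\<bar>f \<omega>\<bar> \<le> sqrt (sin2 u v1) * (norm (Y \<omega>))^2"
      using abs_oja_drift_le[OF u norm_v1] by (simp add: f_def)
    also have "\<dots> \<le> ?R" using elim by (intro mult_left_mono power_mono) (auto simp: sin2_nonneg)
    finally show ?case by (simp add: abs_le_iff minus_le_iff)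
  qed
  then interpret interval_bounded_random_variable M f "- ?R" ?R by unfold_locales simp_all
  have mean: "expectation f \<le> - (eigengap \<Sigma> * sin2 u v1)"
    using expectation_oja_drift_ge[OF u half] unfolding f_def by simp
  have "(\<integral>\<^sup>+\<omega>. exp (l * f \<omega>) \<partial>M)
      = (\<integral>\<^sup>+\<omega>. exp (l * expectation f) * ennreal (exp (l * (f \<omega> - expectation f))) \<partial>M)"
    by (simp add: algebra_simps flip: ennreal_mult exp_add)
  also have "\<dots> = exp (l * expectation f) * (\<integral>\<^sup>+\<omega>. exp (l * (f \<omega> - expectation f)) \<partial>M)"
    by (rule nn_integral_cmult) measurable
  also have "\<dots> \<le> exp (l * expectation f) * ennreal (exp (l^2 * (?R - - ?R)^2 / 8))"
    using \<open>0 < l\<close> by (intro mult_left_mono Hoeffdings_lemma_nn_integral) auto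
  also have "\<dots> = exp (l * expectation f + l^2 * sin2 u v1 * B^4 / 2)"
    by (simp add: power_mult_distrib sin2_nonneg flip: ennreal_mult exp_add)
  also have "\<dots> \<le> exp (- (l * eigengap \<Sigma> * sin2 u v1) + l^2 * sin2 u v1 * B^4 / 2)"
    using mult_left_mono[OF mean, of l] \<open>0 < l\<close> by (simp add: ennreal_leI mult_ac)
  finally show ?thesis by (simp add: f_def)
qed

lemma exp_moment_sin2_oja_step_le:
  assumes pos: "0 < h" "0 < \<theta>" and half: "sin2 v v1 \<le> 1/2"
  shows "(\<integral>\<^sup>+\<omega>. exp (\<theta> * sin2 (oja_step h (Y \<omega>) v) v1) \<partial>M)
    \<le> exp (\<theta> * sin2 v v1 * (1 - h * eigengap \<Sigma> + \<theta> * h^2 * B^4 / 2) + \<theta> * h^2 * B^4 / 4)"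
proof -
  have "v \<noteq> 0" using half by (auto simp: sin2_def)
  define u where "u = sgn v"
  have u: "norm u = 1" using \<open>v \<noteq> 0\<close> by (simp add: u_def norm_sgn)
  define S where "S = sin2 u v1"
  have S: "sin2 v v1 = S" using \<open>v \<noteq> 0\<close> by (simp add: S_def u_def sin2_sgn)
  let ?A = "exp (\<theta> * (S + h^2 * B^4 / 4))"
  have "(\<integral>\<^sup>+\<omega>. exp (\<theta> * sin2 (oja_step h (Y \<omega>) v) v1) \<partial>M)
      \<le> (\<integral>\<^sup>+\<omega>. ?A * ennreal (exp (- (\<theta> * h * oja_drift u v1 (Y \<omega>)))) \<partial>M)"
  proof (rule nn_integral_mono_AE)
    show "AE \<omega> in M. ennreal (exp (\<theta> * sin2 (oja_step h (Y \<omega>) v) v1))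
        \<le> ?A * ennreal (exp (- (\<theta> * h * oja_drift u v1 (Y \<omega>))))"
      using AE_norm_le
    proof eventually_elim
      case (elim \<omega>)
      have "sin2 (oja_step h (Y \<omega>) v) v1 \<le> S - h * oja_drift u v1 (Y \<omega>) + h^2 * (norm (Y \<omega>))^4 / 4"
        using sin2_oja_step_le[OF \<open>v \<noteq> 0\<close> norm_v1] by (simp add: S u_def)
      also have "\<dots> \<le> S - h * oja_drift u v1 (Y \<omega>) + h^2 * B^4 / 4"
        using elim by (intro add_left_mono divide_right_mono mult_left_mono power_mono) auto
      finally have "\<theta> * sin2 (oja_step h (Y \<omega>) v) v1
          \<le> \<theta> * (S - h * oja_drift u v1 (Y \<omega>) + h^2 * B^4 / 4)"
        using pos by (intro mult_left_mono) auto
      then show ?case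
        by (simp add: algebra_simps flip: ennreal_mult exp_add)
    qed
  qed
  also have "\<dots> = ?A * (\<integral>\<^sup>+\<omega>. exp (- (\<theta> * h * oja_drift u v1 (Y \<omega>))) \<partial>M)"
    by (rule nn_integral_cmult) (simp add: oja_drift_def orth_residual_def)
  also have "\<dots> \<le> ?A * ennreal (exp (- (\<theta> * h * eigengap \<Sigma> * S) + (\<theta> * h)^2 * S * B^4 / 2))"
    using pos half unfolding S_def
    by (intro mult_left_mono exp_moment_oja_drift_le u) (auto simp: S S_def)
  also have "\<dots> = exp (\<theta> * S * (1 - h * eigengap \<Sigma> + \<theta> * h^2 * B^4 / 2) + \<theta> * h^2 * B^4 / 4)"
    by (simp add: algebra_simps power2_eq_square flip: ennreal_mult exp_add)
  finally show ?thesis by (simp add: S)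
qed

end

subsection \<open>Maximal inequalities for independent recursions\<close>

lemma Ville_maximal_inequality:
  fixes W :: "nat \<Rightarrow> 'a \<Rightarrow> ennreal"
  assumes [measurable]: "\<And>t. W t \<in> borel_measurable M"
    and super: "\<And>t. t < n \<Longrightarrow> (\<integral>\<^sup>+\<omega>\<in>{\<omega>\<in>space M. \<forall>r\<le>t. W r \<omega> < a}. W (Suc t) \<omega> \<partial>M)
        \<le> (\<integral>\<^sup>+\<omega>\<in>{\<omega>\<in>space M. \<forall>r\<le>t. W r \<omega> < a}. W t \<omega> \<partial>M)"
  shows "a * emeasure M {\<omega>\<in>space M. \<exists>s\<le>n. a \<le> W s \<omega>} \<le> (\<integral>\<^sup>+\<omega>. W 0 \<omega> \<partial>M)"
proof -
  define stopped where "stopped t \<omega> = (if \<exists>s<t. a \<le> W s \<omega> then a else W t \<omega>)" for t \<omega>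
  have decreasing: "(\<integral>\<^sup>+\<omega>. stopped (Suc t) \<omega> \<partial>M) \<le> (\<integral>\<^sup>+\<omega>. stopped t \<omega> \<partial>M)" if "t < n" for t
  proof -
    let ?C = "{\<omega>\<in>space M. \<forall>r\<le>t. W r \<omega> < a}"
    have "(\<integral>\<^sup>+\<omega>. stopped (Suc t) \<omega> \<partial>M)
        = (\<integral>\<^sup>+\<omega>. a * indicator (space M - ?C) \<omega> + W (Suc t) \<omega> * indicator ?C \<omega> \<partial>M)"
      by (intro nn_integral_cong) (auto simp: stopped_def indicator_def less_Suc_eq_le not_less)
    also have "\<dots> = (\<integral>\<^sup>+\<omega>. a * indicator (space M - ?C) \<omega> \<partial>M) + (\<integral>\<^sup>+\<omega>\<in>?C. W (Suc t) \<omega> \<partial>M)"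
      by (rule nn_integral_add) measurable
    also have "\<dots> \<le> (\<integral>\<^sup>+\<omega>. a * indicator (space M - ?C) \<omega> \<partial>M) + (\<integral>\<^sup>+\<omega>\<in>?C. W t \<omega> \<partial>M)"
      by (intro add_left_mono super that)
    also have "\<dots> = (\<integral>\<^sup>+\<omega>. a * indicator (space M - ?C) \<omega> + W t \<omega> * indicator ?C \<omega> \<partial>M)"
      by (rule nn_integral_add[symmetric]) measurable
    also have "\<dots> \<le> (\<integral>\<^sup>+\<omega>. stopped t \<omega> \<partial>M)"
    proof (rule nn_integral_mono)
      fix \<omega> assume "\<omega> \<in> space M"
      then have "\<omega> \<in> ?C \<longleftrightarrow> \<not> (\<exists>s<t. a \<le> W s \<omega>) \<and> \<not> a \<le> W t \<omega>"
        by (auto simp: le_eq_less_or_eq not_le)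
      then show "a * indicator (space M - ?C) \<omega> + W t \<omega> * indicator ?C \<omega> \<le> stopped t \<omega>"
        using \<open>\<omega> \<in> space M\<close> by (simp add: stopped_def indicator_def)
    qed
    finally show ?thesis .
  qed
  have "a * emeasure M {\<omega>\<in>space M. \<exists>s\<le>n. a \<le> W s \<omega>}
      = (\<integral>\<^sup>+\<omega>. a * indicator {\<omega>\<in>space M. \<exists>s\<le>n. a \<le> W s \<omega>} \<omega> \<partial>M)"
    by (rule nn_integral_cmult_indicator[symmetric]) measurable
  also have "\<dots> \<le> (\<integral>\<^sup>+\<omega>. stopped n \<omega> \<partial>M)"
    by (intro nn_integral_mono) (auto simp: stopped_def indicator_def le_eq_less_or_eq)
  also have "\<dots> \<le> (\<integral>\<^sup>+\<omega>. stopped 0 \<omega> \<partial>M)"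
    using decreasing by (induction n) (auto intro: order_trans)
  finally show ?thesis by (simp add: stopped_def)
qed

lemma (in prob_space) nn_integral_indep_var:
  assumes indep: "indep_var S X T Y" and [measurable]: "f \<in> borel_measurable (S \<Otimes>\<^sub>M T)"
  shows "(\<integral>\<^sup>+\<omega>. f (X \<omega>, Y \<omega>) \<partial>M) = (\<integral>\<^sup>+\<omega>. \<integral>\<^sup>+\<omega>'. f (X \<omega>, Y \<omega>') \<partial>M \<partial>M)"
proof -
  have [measurable]: "X \<in> measurable M S" "Y \<in> measurable M T"
    and joint: "distr M S X \<Otimes>\<^sub>M distr M T Y = distr M (S \<Otimes>\<^sub>M T) (\<lambda>\<omega>. (X \<omega>, Y \<omega>))"
    using indep by (auto simp: indep_var_distribution_eq)
  interpret T: prob_space "distr M T Y" by (rule prob_space_distr) simp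
  have "(\<integral>\<^sup>+\<omega>. f (X \<omega>, Y \<omega>) \<partial>M) = (\<integral>\<^sup>+z. f z \<partial>(distr M S X \<Otimes>\<^sub>M distr M T Y))"
    unfolding joint by (subst nn_integral_distr) simp_all
  also have "\<dots> = (\<integral>\<^sup>+x. \<integral>\<^sup>+y. f (x, y) \<partial>distr M T Y \<partial>distr M S X)"
    by (rule T.nn_integral_fst[symmetric]) (simp cong: measurable_cong_sets)
  also have "\<dots> = (\<integral>\<^sup>+\<omega>. \<integral>\<^sup>+y. f (X \<omega>, y) \<partial>distr M T Y \<partial>M)"
    by (rule nn_integral_distr) simp_all
  also have "\<dots> = (\<integral>\<^sup>+\<omega>. \<integral>\<^sup>+\<omega>'. f (X \<omega>, Y \<omega>') \<partial>M \<partial>M)"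
    by (intro nn_integral_cong nn_integral_distr) simp_all
  finally show ?thesis .
qed

lemma (in finite_measure) measure_UN_le_inverse_squares:
  assumes [measurable]: "\<And>k. A k \<in> sets M" and A: "\<And>k. measure M (A k) \<le> c / (real k + 1)^2"
  shows "measure M (\<Union>k. A k) \<le> c * (pi^2 / 6)"
proof -
  have sums: "(\<lambda>k. c / (real k + 1)^2) sums (c * (pi^2 / 6))"
    using sums_mult[OF inverse_squares_sums, of c] by (simp add: add.commute)
  then have summable: "summable (\<lambda>k. measure M (A k))"
    using A by (intro summable_comparison_test'[OF sums_summable]) auto
  have "measure M (\<Union>k. A k) \<le> (\<Sum>k. measure M (A k))"
    using summable by (intro finite_measure_subadditive_countably) auto
  also have "\<dots> \<le> (\<Sum>k. c / (real k + 1)^2)"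
    by (intro suminf_le A summable sums_summable[OF sums])
  also have "\<dots> = c * (pi^2 / 6)" using sums by (rule sums_unique[symmetric])
  finally show ?thesis .
qed

locale independent_recursion = prob_space M for M :: "'a measure" +
  fixes N :: "'b measure" and Y V :: "nat \<Rightarrow> 'a \<Rightarrow> 'b" and step :: "nat \<Rightarrow> 'b \<Rightarrow> 'b \<Rightarrow> 'b"
  assumes indep_vars: "indep_vars (\<lambda>_. N) Y UNIV"
    and V_0: "V 0 \<omega> = Y 0 \<omega>"
    and V_Suc: "V (Suc t) \<omega> = step t (Y (Suc t) \<omega>) (V t \<omega>)"
    and measurable_step[measurable]: "(\<lambda>(x, v). step t x v) \<in> measurable (N \<Otimes>\<^sub>M N) N"
begin

abbreviation paths :: "nat \<Rightarrow> (nat \<Rightarrow> 'b) measure" where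
  "paths t \<equiv> PiM {..t} (\<lambda>_. N)"

abbreviation inputs :: "nat \<Rightarrow> 'a \<Rightarrow> nat \<Rightarrow> 'b" where
  "inputs t \<omega> \<equiv> restrict (\<lambda>i. Y i \<omega>) {..t}"

lemma measurable_Y[measurable]: "Y t \<in> measurable M N"
  using indep_vars by (simp add: indep_vars_def)

lemma measurable_V[measurable]: "V t \<in> measurable M N"
proof (induction t)
  case 0
  then show ?case using measurable_Y[of 0] by (simp add: V_0 cong: measurable_cong)
next
  case (Suc t)
  note [measurable] = Suc
  show ?case by (subst measurable_cong[OF V_Suc]) measurable
qed

lemma V_eq_function_of_inputs:
  assumes "s \<le> t"
  shows "\<exists>\<phi>\<in>measurable (paths t) N. \<forall>\<omega>. V s \<omega> = \<phi> (inputs t \<omega>)"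
  using assms
proof (induction s)
  case 0
  show ?case
    by (rule bexI[of _ "\<lambda>w. w 0"]) (auto simp: V_0 intro!: measurable_component_singleton)
next
  case (Suc s)
  then obtain \<phi> where [measurable]: "\<phi> \<in> measurable (paths t) N"
    and \<phi>: "\<forall>\<omega>. V s \<omega> = \<phi> (inputs t \<omega>)"
    using Suc_leD by blast
  have [measurable]: "(\<lambda>w. w (Suc s)) \<in> measurable (paths t) N"
    using Suc.prems by (intro measurable_component_singleton) simp
  show ?case
  proof (intro bexI allI)
    show "V (Suc s) \<omega> = step s (inputs t \<omega> (Suc s)) (\<phi> (inputs t \<omega>))" for \<omega>
      using Suc.prems \<phi> by (simp add: V_Suc)
    show "(\<lambda>w. step s (w (Suc s)) (\<phi> w)) \<in> measurable (paths t) N" by measurable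
  qed
qed

definition history :: "nat \<Rightarrow> 'a \<Rightarrow> nat \<Rightarrow> 'b" where
  "history t \<omega> = restrict (\<lambda>s. V s \<omega>) {..t}"

lemma history_eq_function_of_inputs:
  "\<exists>\<Phi>\<in>measurable (paths t) (paths t). \<forall>\<omega>. history t \<omega> = \<Phi> (inputs t \<omega>)"
proof -
  have "\<forall>s\<in>{..t}. \<exists>\<phi>\<in>measurable (paths t) N. \<forall>\<omega>. V s \<omega> = \<phi> (inputs t \<omega>)"
    using V_eq_function_of_inputs by simp
  then obtain \<phi> where \<phi>: "\<forall>s\<in>{..t}. \<phi> s \<in> measurable (paths t) N"
    and V_eq: "\<forall>s\<in>{..t}. \<forall>\<omega>. V s \<omega> = \<phi> s (inputs t \<omega>)"
    by metis
  show ?thesis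
  proof (rule bexI)
    show "(\<lambda>w. restrict (\<lambda>s. \<phi> s w) {..t}) \<in> measurable (paths t) (paths t)"
      using \<phi> by (intro measurable_restrict) auto
    show "\<forall>\<omega>. history t \<omega> = restrict (\<lambda>s. \<phi> s (inputs t \<omega>)) {..t}"
      using V_eq by (auto simp: history_def intro!: restrict_ext)
  qed
qed

lemma nn_integral_history_next:
  assumes [measurable]: "f \<in> borel_measurable (paths t \<Otimes>\<^sub>M N)"
  shows "(\<integral>\<^sup>+\<omega>. f (history t \<omega>, Y (Suc t) \<omega>) \<partial>M)
    = (\<integral>\<^sup>+\<omega>. \<integral>\<^sup>+\<omega>'. f (history t \<omega>, Y (Suc t) \<omega>') \<partial>M \<partial>M)"
proof -
  obtain \<Phi> where [measurable]: "\<Phi> \<in> measurable (paths t) (paths t)"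
    and history_eq: "\<forall>\<omega>. history t \<omega> = \<Phi> (inputs t \<omega>)"
    using history_eq_function_of_inputs by blast
  have [measurable]: "(\<lambda>z. z (Suc t)) \<in> measurable (PiM {Suc t} (\<lambda>_. N)) N"
    by (rule measurable_component_singleton) simp
  have "indep_var (paths t) (inputs t) (PiM {Suc t} (\<lambda>_. N)) (\<lambda>\<omega>. restrict (\<lambda>i. Y i \<omega>) {Suc t})"
    by (rule indep_var_restrict[OF indep_vars]) auto
  from nn_integral_indep_var[OF this, of "\<lambda>(w, z). f (\<Phi> w, z (Suc t))"]
  show ?thesis by (simp add: history_eq)
qed

lemma nn_integral_history_next_le:
  assumes [measurable]: "Q \<in> sets (paths t)"
      "f \<in> borel_measurable N" "g \<in> borel_measurable N"
    and drift: "\<And>\<omega>. \<omega> \<in> space M \<Longrightarrow> history t \<omega> \<in> Q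
      \<Longrightarrow> (\<integral>\<^sup>+\<omega>'. f (step t (Y (Suc t) \<omega>') (V t \<omega>)) \<partial>M) \<le> g (V t \<omega>)"
  shows "(\<integral>\<^sup>+\<omega>\<in>{\<omega>\<in>space M. history t \<omega> \<in> Q}. f (V (Suc t) \<omega>) \<partial>M)
    \<le> (\<integral>\<^sup>+\<omega>\<in>{\<omega>\<in>space M. history t \<omega> \<in> Q}. g (V t \<omega>) \<partial>M)"
proof -
  have [measurable]: "(\<lambda>w. w t) \<in> measurable (paths t) N"
    by (rule measurable_component_singleton) simp
  have "(\<integral>\<^sup>+\<omega>\<in>{\<omega>\<in>space M. history t \<omega> \<in> Q}. f (V (Suc t) \<omega>) \<partial>M)
      = (\<integral>\<^sup>+\<omega>. (case (history t \<omega>, Y (Suc t) \<omega>) of (w, x) \<Rightarrow> f (step t x (w t)) * indicator Q w) \<partial>M)"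
    by (intro nn_integral_cong) (simp add: V_Suc history_def indicator_def)
  also have "\<dots> = (\<integral>\<^sup>+\<omega>. \<integral>\<^sup>+\<omega>'. f (step t (Y (Suc t) \<omega>') (V t \<omega>)) * indicator Q (history t \<omega>) \<partial>M \<partial>M)"
    by (subst nn_integral_history_next) (simp_all add: history_def)
  also have "\<dots> \<le> (\<integral>\<^sup>+\<omega>\<in>{\<omega>\<in>space M. history t \<omega> \<in> Q}. g (V t \<omega>) \<partial>M)"
    by (intro nn_integral_mono) (simp add: drift indicator_def)
  finally show ?thesis .
qed

lemma localized_maximal_inequality:
  fixes g :: "nat \<Rightarrow> 'b \<Rightarrow> ennreal"
  assumes g[measurable]: "\<And>t. g t \<in> borel_measurable N"
    and [measurable]: "G0 \<in> sets N" "G \<in> sets N"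
    and drift: "\<And>t v. t < n \<Longrightarrow> v \<in> G \<Longrightarrow> (\<integral>\<^sup>+\<omega>. g (Suc t) (step t (Y (Suc t) \<omega>) v) \<partial>M) \<le> g t v"
    and "0 < a"
  shows "a * emeasure M {\<omega>\<in>space M. \<exists>s\<le>n. V 0 \<omega> \<in> G0 \<and> (\<forall>r<s. V r \<omega> \<in> G) \<and> a \<le> g s (V s \<omega>)}
    \<le> (\<integral>\<^sup>+\<omega>. g 0 (V 0 \<omega>) * indicator G0 (V 0 \<omega>) \<partial>M)"
proof -
  let ?L = "\<lambda>s. {\<omega>\<in>space M. V 0 \<omega> \<in> G0 \<and> (\<forall>r<s. V r \<omega> \<in> G)}"
  define W where "W s \<omega> = g s (V s \<omega>) * indicator (?L s) \<omega>" for s \<omega>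
  have [measurable]: "W s \<in> borel_measurable M" for s unfolding W_def by measurable
  have "a * emeasure M {\<omega>\<in>space M. \<exists>s\<le>n. a \<le> W s \<omega>} \<le> (\<integral>\<^sup>+\<omega>. W 0 \<omega> \<partial>M)"
  proof (rule Ville_maximal_inequality)
    fix t assume "t < n"
    let ?C = "{\<omega>\<in>space M. \<forall>r\<le>t. W r \<omega> < a}"
    \<comment> \<open>Membership in ?L (Suc t) is already decided at time t, so killing W outside ?L preserves
      the supermartingale property.\<close>
    define Q where "Q = {w\<in>space (paths t). w 0 \<in> G0
      \<and> (\<forall>r\<in>{..t}. w r \<in> G \<and> g r (w r) < a)}"
    have [measurable]: "(\<lambda>w. w r) \<in> measurable (paths t) N" if "r \<in> {..t}" for r
      using that by (rule measurable_component_singleton)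
    have [measurable]: "Q \<in> sets (paths t)"
      unfolding Q_def by measurable
    have history_in_Q: "history t \<omega> \<in> Q \<longleftrightarrow> \<omega> \<in> ?C \<and> \<omega> \<in> ?L (Suc t)" if "\<omega> \<in> space M" for \<omega>
      using that measurable_space[OF measurable_V]
      by (auto simp: Q_def W_def history_def space_PiM less_Suc_eq_le)
    have "(\<integral>\<^sup>+\<omega>\<in>?C. W (Suc t) \<omega> \<partial>M)
        = (\<integral>\<^sup>+\<omega>\<in>{\<omega>\<in>space M. history t \<omega> \<in> Q}. g (Suc t) (V (Suc t) \<omega>) \<partial>M)"
      by (intro nn_integral_cong) (auto simp: W_def indicator_def history_in_Q)
    also have "\<dots> \<le> (\<integral>\<^sup>+\<omega>\<in>{\<omega>\<in>space M. history t \<omega> \<in> Q}. g t (V t \<omega>) \<partial>M)"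
      by (intro nn_integral_history_next_le drift \<open>t < n\<close>) (auto simp: history_in_Q)
    also have "\<dots> \<le> (\<integral>\<^sup>+\<omega>\<in>?C. W t \<omega> \<partial>M)"
      by (intro nn_integral_mono) (auto simp: W_def indicator_def history_in_Q)
    finally show "(\<integral>\<^sup>+\<omega>\<in>?C. W (Suc t) \<omega> \<partial>M) \<le> (\<integral>\<^sup>+\<omega>\<in>?C. W t \<omega> \<partial>M)" .
  qed measurable
  moreover have "{\<omega>\<in>space M. \<exists>s\<le>n. a \<le> W s \<omega>}
      = {\<omega>\<in>space M. \<exists>s\<le>n. V 0 \<omega> \<in> G0 \<and> (\<forall>r<s. V r \<omega> \<in> G) \<and> a \<le> g s (V s \<omega>)}"
    using \<open>0 < a\<close> by (auto simp: W_def indicator_def)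
  moreover have "(\<integral>\<^sup>+\<omega>. W 0 \<omega> \<partial>M) = (\<integral>\<^sup>+\<omega>. g 0 (V 0 \<omega>) * indicator G0 (V 0 \<omega>) \<partial>M)"
    by (intro nn_integral_cong) (simp add: W_def indicator_def)
  ultimately show ?thesis by simp
qed

end

subsection \<open>Weights and potentials\<close>

definition weight :: "real \<Rightarrow> real \<Rightarrow> real \<Rightarrow> real" where
  "weight b H r = r * sqrt (r / H) / (4 * b)"

definition potential :: "real \<Rightarrow> real \<Rightarrow> real \<Rightarrow> real \<Rightarrow> real" where
  "potential b H r x = exp (weight b H r * x - sqrt (r / H) / 2)"

lemma weight_pos: "0 < b \<Longrightarrow> 0 < H \<Longrightarrow> 0 < r \<Longrightarrow> 0 < weight b H r"
  by (simp add: weight_def)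

lemma borel_measurable_potential[measurable]:
  assumes [measurable]: "f \<in> borel_measurable N"
  shows "(\<lambda>x. potential b H r (f x)) \<in> borel_measurable N"
  unfolding potential_def by measurable

lemma potential_le_exp_weight:
  assumes "0 < b" "0 < H" "0 < r" "x \<le> c"
  shows "potential b H r x \<le> exp (weight b H r * c)"
proof -
  have "weight b H r * x \<le> weight b H r * c"
    using assms weight_pos[of b H r] by (intro mult_left_mono) auto
  moreover have "0 \<le> sqrt (r / H)" using assms by simp
  ultimately show ?thesis unfolding potential_def exp_le_cancel_iff by linarith
qed

text \<open>The tangent at r of the convex function x sqrt x lies below the function at r - 1.\<close>

lemma tangent_mult_sqrt_le:
  fixes r :: real
  assumes "1 < r"
  shows "sqrt r * (r - 3/2) \<le> (r - 1) * sqrt (r - 1)"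
proof (cases "3/2 \<le> r")
  case True
  then have "r * (r - 3/2)^2 \<le> (r - 1)^2 * (r - 1)"
    by (simp add: power2_eq_square algebra_simps)
  then have "sqrt (r * (r - 3/2)^2) \<le> sqrt ((r - 1)^2 * (r - 1))"
    by (rule real_sqrt_le_mono)
  then show ?thesis using True by (simp add: real_sqrt_mult)
next
  case False
  then have "sqrt r * (r - 3/2) \<le> 0" using assms by (intro mult_nonneg_nonpos) auto
  also have "0 \<le> (r - 1) * sqrt (r - 1)" using assms by simp
  finally show ?thesis .
qed

lemma weight_mult_le_previous:
  assumes b: "0 < b" and r: "1 < r" "r \<le> H"
  shows "weight b H r * (1 - 2 / r + 2 * weight b H r * b / r^2) \<le> weight b H (r - 1)"
proof -
  have "2 * weight b H r * b / r^2 = sqrt (r / H) / (2 * r)"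
    using b r by (simp add: weight_def power2_eq_square field_simps)
  also have "\<dots> \<le> 1 / (2 * r)" using r by (intro divide_right_mono) auto
  finally have "1 - 2 / r + 2 * weight b H r * b / r^2 \<le> 1 - 3 / (2 * r)"
    using r by (simp add: field_simps)
  then have "weight b H r * (1 - 2 / r + 2 * weight b H r * b / r^2)
      \<le> weight b H r * (1 - 3 / (2 * r))"
    using b r by (intro mult_left_mono) (simp_all add: weight_pos less_imp_le)
  also have "\<dots> = sqrt r * (r - 3/2) / (4 * b * sqrt H)"
    using b r by (simp add: weight_def real_sqrt_divide field_simps)
  also have "\<dots> \<le> (r - 1) * sqrt (r - 1) / (4 * b * sqrt H)"
    using b r by (intro divide_right_mono tangent_mult_sqrt_le) auto
  also have "\<dots> = weight b H (r - 1)"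
    by (simp add: weight_def real_sqrt_divide)
  finally show ?thesis .
qed

lemma weight_div_square_le:
  assumes b: "0 < b" and r: "1 < r" and H: "0 < H"
  shows "weight b H r * b / r^2 \<le> sqrt (r / H) / 2 - sqrt ((r - 1) / H) / 2"
proof -
  have "1 = (sqrt r - sqrt (r - 1)) * (sqrt r + sqrt (r - 1))"
    using r by (simp add: algebra_simps)
  also have "\<dots> \<le> (sqrt r - sqrt (r - 1)) * (2 * sqrt r)"
    using r by (intro mult_left_mono) auto
  finally have "1 / (2 * sqrt r) \<le> sqrt r - sqrt (r - 1)"
    using r by (simp add: field_simps)
  then have "1 / (2 * sqrt r) / (2 * sqrt H) \<le> (sqrt r - sqrt (r - 1)) / (2 * sqrt H)"
    using H by (intro divide_right_mono) auto
  moreover have "weight b H r * b / r^2 = sqrt r / r / (4 * sqrt H)"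
    using b r by (simp add: weight_def real_sqrt_divide power2_eq_square)
  then have "weight b H r * b / r^2 = 1 / (2 * sqrt r) / (2 * sqrt H)"
    using r by (simp add: sqrt_divide_self_eq inverse_eq_divide)
  moreover have "sqrt (r / H) / 2 - sqrt ((r - 1) / H) / 2 = (sqrt r - sqrt (r - 1)) / (2 * sqrt H)"
    unfolding real_sqrt_divide by (simp add: diff_divide_distrib)
  ultimately show ?thesis by simp
qed

lemma (in eigengap_random_vector) nn_integral_potential_oja_step_le:
  assumes B: "0 < B" and r: "1 < r" "r \<le> H" and half: "sin2 v v1 \<le> 1/2"
    and b: "b = B^4 / (eigengap \<Sigma>)^2" and h: "h = 2 / (eigengap \<Sigma> * r)"
  shows "(\<integral>\<^sup>+\<omega>. potential b H r (sin2 (oja_step h (Y \<omega>) v) v1) \<partial>M)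
    \<le> potential b H (r - 1) (sin2 v v1)"
proof -
  let ?S = "sin2 v v1" and ?\<theta> = "weight b H r" and ?k = "sqrt (r / H) / 2"
  have pos: "0 < b" "0 < h" "0 < ?\<theta>"
    using B r eigengap_pos by (auto simp: b h intro!: weight_pos)
  have step_size: "h * eigengap \<Sigma> = 2 / r" "h^2 * B^4 = 4 * b / r^2"
    using eigengap_pos by (simp_all add: b h power_divide power_mult_distrib)
  have "?S * (?\<theta> * (1 - 2 / r + 2 * ?\<theta> * b / r^2)) \<le> ?S * weight b H (r - 1)"
    by (intro mult_left_mono weight_mult_le_previous pos r sin2_nonneg)
  moreover have "?\<theta> * b / r^2 \<le> ?k - sqrt ((r - 1) / H) / 2"
    using pos r by (intro weight_div_square_le) auto
  ultimately have exponent_le: "?S * (?\<theta> * (1 - 2 / r + 2 * ?\<theta> * b / r^2)) + ?\<theta> * b / r^2 - ?k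
      \<le> weight b H (r - 1) * ?S - sqrt ((r - 1) / H) / 2"
    by (simp add: mult.commute)
  have "(\<integral>\<^sup>+\<omega>. potential b H r (sin2 (oja_step h (Y \<omega>) v) v1) \<partial>M)
      = (\<integral>\<^sup>+\<omega>. exp (- ?k) * ennreal (exp (?\<theta> * sin2 (oja_step h (Y \<omega>) v) v1)) \<partial>M)"
    by (simp add: potential_def flip: ennreal_mult exp_add)
  also have "\<dots> = exp (- ?k) * (\<integral>\<^sup>+\<omega>. exp (?\<theta> * sin2 (oja_step h (Y \<omega>) v) v1) \<partial>M)"
    by (rule nn_integral_cmult) (simp add: sin2_def oja_step_def)
  also have "\<dots> \<le> exp (- ?k) * ennreal (exp (?\<theta> * ?S * (1 - h * eigengap \<Sigma> + ?\<theta> * h^2 * B^4 / 2)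
      + ?\<theta> * h^2 * B^4 / 4))"
    by (intro mult_left_mono exp_moment_sin2_oja_step_le pos half) simp
  also have "\<dots> = exp (?S * (?\<theta> * (1 - 2 / r + 2 * ?\<theta> * b / r^2)) + ?\<theta> * b / r^2 - ?k)"
    unfolding step_size mult.assoc[of ?\<theta> "h^2"]
    by (simp add: algebra_simps flip: ennreal_mult exp_add)
  also have "\<dots> \<le> potential b H (r - 1) ?S"
    unfolding potential_def using exponent_le by (simp add: ennreal_leI)
  finally show ?thesis .
qed

subsection \<open>From the absence of crossings to the rate\<close>

lemma mult_le_if_potential_less:
  assumes b: "0 < b" and r: "0 < L" "L \<le> r" "r \<le> H" "H \<le> 4 * r" and R: "0 \<le> R"
    and less: "potential b H r x < exp (weight b H L / 4 + R)"
  shows "r * x \<le> L / 4 + 8 * b * (1/2 + R)"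
proof -
  define q where "q = sqrt (r / H)"
  have H: "0 < H" using r by simp
  have "sqrt (1/4) \<le> q"
    unfolding q_def using r H by (intro real_sqrt_le_mono) (simp add: field_simps)
  then have q: "1/2 \<le> q" "q \<le> 1" using r H by (simp_all add: real_sqrt_divide q_def)
  have sqrt_L: "sqrt (L / H) \<le> q"
    unfolding q_def using r H by (intro real_sqrt_le_mono divide_right_mono) auto
  have "weight b H r * x \<le> weight b H L / 4 + (1/2 + R)"
    using less q by (simp add: potential_def flip: q_def)
  then have "4 * b * (weight b H r * x) \<le> 4 * b * (weight b H L / 4 + (1/2 + R))"
    using b by (intro mult_left_mono) auto
  moreover have "4 * b * (weight b H r * x) = q * (r * x)"
    and "4 * b * (weight b H L / 4 + (1/2 + R)) = L * sqrt (L / H) / 4 + 4 * b * (1/2 + R)"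
    using b by (simp_all add: weight_def q_def distrib_left)
  ultimately have "q * (r * x) \<le> L * sqrt (L / H) / 4 + 4 * b * (1/2 + R)" by simp
  also have "\<dots> \<le> L * q / 4 + (4 * b * (1/2 + R)) * (2 * q)"
  proof (rule add_mono)
    show "L * sqrt (L / H) / 4 \<le> L * q / 4" using sqrt_L r by simp
    show "4 * b * (1/2 + R) \<le> (4 * b * (1/2 + R)) * (2 * q)"
      using b R q mult_left_mono[of 1 "2 * q" "4 * b * (1/2 + R)"] by simp
  qed
  also have "\<dots> = q * (L / 4 + 8 * b * (1/2 + R))" by (simp add: algebra_simps)
  finally show ?thesis using q by simp
qed

lemma ex_power_ivl_real:
  fixes x :: real
  assumes "2 \<le> c" "1 \<le> x"
  obtains k where "real c ^ k \<le> x" "x < real c ^ (k + 1)"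
proof -
  have "1 \<le> nat \<lfloor>x\<rfloor>" using assms(2) by (simp add: le_nat_floor)
  from ex_power_ivl1[OF assms(1) this] obtain k
    where k: "c ^ k \<le> nat \<lfloor>x\<rfloor>" "nat \<lfloor>x\<rfloor> < c ^ (k + 1)" by auto
  have "real (c ^ k) \<le> x"
    using k(1) of_nat_floor[of x] assms(2) by (meson of_nat_le_iff order_trans zero_le_one)
  moreover have "x < real (c ^ (k + 1))" using k(2) assms(2) by linarith
  ultimately show thesis using that by simp
qed

lemma stitching_cost_le:
  assumes l: "1 \<le> l" and b: "0 < b" "128 * b * l^2 \<le> L" and r: "4^k * L \<le> r"
  shows "8 * b * (1/2 + (l + 2 * ln (real k + 1))) \<le> r / 4"
proof -
  have square: "l \<le> l^2" "1 \<le> l^2" using l by (simp_all add: self_le_power)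
  have "ln (real k + 1) \<le> real k"
    using ln_add_one_self_le_self[of "real k"] by (simp add: add.commute)
  then have "1/2 + (l + 2 * ln (real k + 1)) \<le> 1/2 * l^2 + l^2 + (2 * real k) * 1"
    using square by linarith
  also have "\<dots> \<le> 1/2 * l^2 + l^2 + (2 * real k) * l^2"
    using square by (intro add_left_mono mult_left_mono) auto
  also have "\<dots> = (3/2 + 2 * real k) * l^2" by (simp add: algebra_simps)
  also have "\<dots> \<le> (4 * 4^k) * l^2"
    using Bernoulli_inequality[of "3::real" k] by (intro mult_right_mono) auto
  finally have "8 * b * (1/2 + (l + 2 * ln (real k + 1))) \<le> 8 * b * ((4 * 4^k) * l^2)"
    using b by (intro mult_left_mono) auto
  also have "\<dots> = 4^k * (128 * b * l^2) / 4" by simp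
  also have "\<dots> \<le> 4^k * L / 4" using b by (intro divide_right_mono mult_left_mono) auto
  finally show ?thesis using r by simp
qed

lemma ln_Suc_le_ln_ln:
  fixes t :: real
  assumes "0 \<le> t" "4^k \<le> t + 1"
  shows "ln (real k + 1) \<le> ln (2 * ln (t + 9))"
proof -
  have "exp (real k) = exp 1 ^ k" by (simp flip: exp_of_nat_mult)
  also have "\<dots> \<le> 4^k" using exp_le by (intro power_mono) auto
  also have "\<dots> \<le> t + 9" using assms by simp
  finally have "real k \<le> ln (t + 9)" using assms by (simp add: ln_ge_iff)
  moreover have "1 \<le> ln (t + 9)" using exp_le assms by (simp add: ln_ge_iff)
  ultimately show ?thesis by simp
qed

definition horizon :: "real \<Rightarrow> nat \<Rightarrow> real" where
  "horizon L k = 4^(k + 1) * L"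

definition level :: "real \<Rightarrow> real \<Rightarrow> real \<Rightarrow> nat \<Rightarrow> real" where
  "level b L l k = exp (weight b (horizon L k) L / 4 + (l + 2 * ln (real k + 1)))"

lemma rate_if_no_crossing:
  fixes e :: "nat \<Rightarrow> real"
  assumes l: "1 \<le> l" and b: "0 < b" "128 * b * l^2 \<le> L" and L: "1 \<le> L"
    and no_crossing: "\<And>k s. real s + L \<le> horizon L k \<Longrightarrow> \<forall>r<s. e r \<le> 1/2
        \<Longrightarrow> potential b (horizon L k) (real s + L) (e s) < level b L l k"
  shows "e t \<le> 1/2
    \<and> (real t + L) * e t \<le> L / 4 + 8 * b * (1/2 + (l + 2 * ln (2 * ln (real t + 9))))"
proof (induction t rule: less_induct)
  case (less t)
  let ?r = "real t + L"
  obtain k where "real 4 ^ k \<le> ?r / L" "?r / L < real 4 ^ (k + 1)"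
    by (rule ex_power_ivl_real[of 4 "?r / L"]) (use L in auto)
  then have k: "4^k * L \<le> ?r" "?r \<le> horizon L k" "horizon L k \<le> 4 * ?r"
    using L by (simp_all add: horizon_def field_simps)
  define R where "R = 8 * b * (1/2 + (l + 2 * ln (real k + 1)))"
  have "potential b (horizon L k) ?r (e t) < level b L l k"
    using less by (intro no_crossing k(2)) auto
  then have "?r * e t \<le> L / 4 + R"
    unfolding R_def using L l k by (intro mult_le_if_potential_less[OF b(1)]) (auto simp: level_def)
  moreover have "R \<le> ?r / 4" unfolding R_def by (rule stitching_cost_le[OF l b k(1)])
  moreover have "(4^k - 1) * 1 \<le> (4^k - 1) * L" using L by (intro mult_left_mono) auto
  then have "4^k \<le> real t + 1" using k(1) by (simp add: algebra_simps)
  then have "R \<le> 8 * b * (1/2 + (l + 2 * ln (2 * ln (real t + 9))))"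
    unfolding R_def using b(1) ln_Suc_le_ln_ln[of "real t" k] by (intro mult_left_mono) auto
  moreover have "e t \<le> 1/2"
  proof -
    have "?r * e t \<le> ?r * (1/2)" using calculation(1,2) by simp
    then show ?thesis using L by (simp only: mult_le_cancel_left_pos)
  qed
  ultimately show ?case by linarith
qed

lemma stitched_rate_le:
  fixes t :: real
  assumes l: "1 \<le> l" and b: "0 < b" "128 * b * l^2 \<le> L" and "0 \<le> t"
  shows "L / 4 + 8 * b * (1/2 + (l + 2 * ln (2 * ln (t + 9))))
    \<le> 2 * L / l * (l + 2 * ln (ln (t + 9)))"
proof -
  define m where "m = ln (ln (t + 9))"
  have ln_ge_1: "1 \<le> ln (t + 9)" using exp_le \<open>0 \<le> t\<close> by (simp add: ln_ge_iff)
  then have "0 \<le> m" by (simp add: m_def)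
  have "b * l \<le> b * l^2" using b(1) l by (intro mult_left_mono) (simp_all add: self_le_power)
  moreover have "0 < b * l^2" using b(1) l by simp
  ultimately have "28 * b * l \<le> L" "0 < L" using b(2) by linarith+
  then have b_le: "28 * b \<le> L / l" using l by (simp add: pos_le_divide_eq)
  have "ln (2 * ln (t + 9)) \<le> 1 + m" using ln_ge_1 ln_2_less_1 by (simp add: m_def ln_mult)
  then have "1/2 + (l + 2 * ln (2 * ln (t + 9))) \<le> 1/2 + (l + 2 * (1 + m))" by simp
  also have "\<dots> \<le> 7/2 * (l + 2 * m)" using l \<open>0 \<le> m\<close> by simp
  finally have "1/2 + (l + 2 * ln (2 * ln (t + 9))) \<le> 7/2 * (l + 2 * m)" .
  then have "8 * b * (1/2 + (l + 2 * ln (2 * ln (t + 9)))) \<le> 8 * b * (7/2 * (l + 2 * m))"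
    using b(1) by (intro mult_left_mono) auto
  also have "\<dots> = 28 * b * (l + 2 * m)" by simp
  also have "\<dots> \<le> L / l * (l + 2 * m)" using b_le l \<open>0 \<le> m\<close> by (intro mult_right_mono) auto
  finally have "8 * b * (1/2 + (l + 2 * ln (2 * ln (t + 9)))) \<le> L / l * (l + 2 * m)" .
  moreover have "L / 4 \<le> L / l * (l + 2 * m)"
  proof -
    have "L / 4 \<le> L / l * l" using l \<open>0 < L\<close> by simp
    also have "\<dots> \<le> L / l * (l + 2 * m)" using l \<open>0 < L\<close> \<open>0 \<le> m\<close> by (intro mult_left_mono) auto
    finally show ?thesis .
  qed
  ultimately show ?thesis by (simp add: m_def)
qed

subsection \<open>The uniform rate\<close>

locale krasulina_oja = prob_space M for M :: "'a measure" +
  fixes X :: "nat \<Rightarrow> 'a \<Rightarrow> real^'n" and v0 :: "'a \<Rightarrow> real^'n"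
    and B :: real and \<Sigma> :: "real^'n^'n" and v1 :: "real^'n"
    and L :: real and \<eta> :: "nat \<Rightarrow> real"
  assumes dim_ge_2: "2 \<le> CARD('n)"
    and indep: "indep_vars (\<lambda>_. borel) (\<lambda>t. if t = 0 then v0 else X t) UNIV"
    and bounded: "\<And>t. 1 \<le> t \<Longrightarrow> AE \<omega> in M. norm (X t \<omega>) \<le> B"
    and covariance: "\<And>t. 1 \<le> t \<Longrightarrow> cov_matrix M (X t) = \<Sigma>"
    and gap: "0 < eigengap \<Sigma>"
    and v1: "norm v1 = 1" "\<Sigma> *v v1 = lambda1 \<Sigma> *\<^sub>R v1"
    and L_ge_1: "1 \<le> L"
    and step_size: "\<And>t. \<eta> t = 2 / (eigengap \<Sigma> * (real t + L))"
begin

definition iterate :: "nat \<Rightarrow> 'a \<Rightarrow> real^'n" where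
  "iterate t \<omega> = kooja \<eta> (\<lambda>s. X s \<omega>) (v0 \<omega>) t"

definition error :: "nat \<Rightarrow> 'a \<Rightarrow> real" where
  "error t \<omega> = sin2 (iterate t \<omega>) v1"

definition \<kappa> :: real where
  "\<kappa> = B^4 / (eigengap \<Sigma>)^2"

sublocale recursion: independent_recursion
  M borel "\<lambda>t. if t = 0 then v0 else X t" iterate "\<lambda>t. oja_step (\<eta> (Suc t))"
proof
  show "(\<lambda>(x, v). oja_step (\<eta> (Suc t)) x v) \<in> measurable (borel \<Otimes>\<^sub>M borel) borel" for t
    by measurable
qed (simp_all add: indep iterate_def kooja_Suc del: kooja.simps(2))

lemma borel_measurable_error[measurable]: "error t \<in> borel_measurable M"
  unfolding error_def by measurable

lemma eigengap_random_vector_X: "1 \<le> t \<Longrightarrow> eigengap_random_vector M (X t) B v1"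
  using recursion.measurable_Y[of t] bounded gap v1 by unfold_locales (auto simp: covariance)

lemma B_pos: "0 < B"
proof -
  interpret eigengap_random_vector M "X 1" B v1 by (rule eigengap_random_vector_X) simp
  have "0 < B^2" using eigengap_le_bound[OF dim_ge_2] eigengap_pos by linarith
  then show ?thesis using bound_nonneg by (simp add: le_less)
qed

lemma \<kappa>_pos: "0 < \<kappa>"
  using B_pos gap by (simp add: \<kappa>_def)

lemma nn_integral_potential_step_le:
  assumes "real (Suc t) + L \<le> H" "sin2 v v1 \<le> 1/2"
  shows "(\<integral>\<^sup>+\<omega>. potential \<kappa> H (real (Suc t) + L)
      (sin2 (oja_step (\<eta> (Suc t)) (X (Suc t) \<omega>) v) v1) \<partial>M)
    \<le> potential \<kappa> H (real t + L) (sin2 v v1)"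
proof -
  interpret eigengap_random_vector M "X (Suc t)" B v1 by (rule eigengap_random_vector_X) simp
  have "real t + L = real (Suc t) + L - 1" by simp
  then show ?thesis
    using assms L_ge_1 B_pos
    by (simp only:)
      (intro nn_integral_potential_oja_step_le, simp_all add: covariance \<kappa>_def step_size)
qed

definition crossing :: "real \<Rightarrow> real \<Rightarrow> 'a set" where
  "crossing H a = {\<omega>\<in>space M. \<exists>s. real s + L \<le> H \<and> error 0 \<omega> \<le> 1/4 \<and> (\<forall>r<s. error r \<omega> \<le> 1/2)
    \<and> a \<le> potential \<kappa> H (real s + L) (error s \<omega>)}"

lemma crossing_sets[measurable]: "crossing H a \<in> sets M"
  unfolding crossing_def by measurable

lemma prob_crossing_le:
  assumes H: "L \<le> H" and a: "0 < a"
  shows "prob (crossing H a) \<le> exp (weight \<kappa> H L / 4) / a"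
proof -
  define n where "n = nat \<lfloor>H - L\<rfloor>"
  have n: "s \<le> n \<longleftrightarrow> real s + L \<le> H" for s
    using H by (simp add: n_def le_nat_iff le_floor_iff algebra_simps)
  let ?g = "\<lambda>t v. ennreal (potential \<kappa> H (real t + L) (sin2 v v1))"
  let ?start = "{v. sin2 v v1 \<le> 1/4}" and ?near = "{v. sin2 v v1 \<le> 1/2}"
  have "ennreal a * emeasure M {\<omega>\<in>space M. \<exists>s\<le>n. iterate 0 \<omega> \<in> ?start \<and> (\<forall>r<s. iterate r \<omega> \<in> ?near)
      \<and> ennreal a \<le> ?g s (iterate s \<omega>)}
    \<le> (\<integral>\<^sup>+\<omega>. ?g 0 (iterate 0 \<omega>) * indicator ?start (iterate 0 \<omega>) \<partial>M)"
  proof (rule recursion.localized_maximal_inequality)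
    fix t v assume "t < n" "v \<in> ?near"
    moreover from this have "real (Suc t) + L \<le> H" using n[of "Suc t"] by simp
    ultimately show "(\<integral>\<^sup>+\<omega>. ?g (Suc t)
          (oja_step (\<eta> (Suc t)) ((if Suc t = 0 then v0 else X (Suc t)) \<omega>) v) \<partial>M) \<le> ?g t v"
      using nn_integral_potential_step_le[of t H v] by simp
  qed (use a in simp_all)
  also have "\<dots> \<le> (\<integral>\<^sup>+\<omega>. exp (weight \<kappa> H L / 4) \<partial>M)"
    using potential_le_exp_weight[of \<kappa> H L _ "1/4"] \<kappa>_pos L_ge_1 H
    by (intro nn_integral_mono) (simp add: indicator_def ennreal_leI)
  also have "\<dots> = exp (weight \<kappa> H L / 4)" by (simp add: emeasure_space_1)
  also have "{\<omega>\<in>space M. \<exists>s\<le>n. iterate 0 \<omega> \<in> ?start \<and> (\<forall>r<s. iterate r \<omega> \<in> ?near)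
      \<and> ennreal a \<le> ?g s (iterate s \<omega>)} = crossing H a"
    by (simp add: crossing_def error_def n potential_def)
  finally have "ennreal (a * prob (crossing H a)) \<le> ennreal (exp (weight \<kappa> H L / 4))"
    using a by (simp add: emeasure_eq_measure ennreal_mult)
  then show ?thesis using a by (simp add: pos_le_divide_eq mult.commute)
qed

definition crossings :: "real \<Rightarrow> 'a set" where
  "crossings l = (\<Union>k. crossing (horizon L k) (level \<kappa> L l k))"

lemma crossings_sets[measurable]: "crossings l \<in> sets M"
  unfolding crossings_def by measurable

lemma prob_crossings_le: "prob (crossings l) \<le> 3 * exp (- l)"
proof -
  have "prob (crossing (horizon L k) (level \<kappa> L l k)) \<le> exp (- l) / (real k + 1)^2" for k
  proof -
    have "L \<le> horizon L k"
      using L_ge_1 one_le_power[of "4::real" "k + 1"] by (simp add: horizon_def)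
    then have "prob (crossing (horizon L k) (level \<kappa> L l k))
        \<le> exp (weight \<kappa> (horizon L k) L / 4) / level \<kappa> L l k"
      by (rule prob_crossing_le) (simp add: level_def)
    moreover have "level \<kappa> L l k = exp (weight \<kappa> (horizon L k) L / 4) * (exp l * (real k + 1)^2)"
      by (simp add: level_def exp_add exp_double)
    ultimately show ?thesis by (simp add: exp_minus divide_simps)
  qed
  then have "prob (crossings l) \<le> exp (- l) * (pi^2 / 6)"
    unfolding crossings_def by (intro measure_UN_le_inverse_squares) auto
  also have "\<dots> \<le> exp (- l) * 3"
  proof -
    have "pi^2 \<le> 4^2" using pi_less_4 by (intro power_mono) auto
    then show ?thesis by (intro mult_left_mono) auto
  qed
  finally show ?thesis by simp
qed

lemma error_le_if_no_crossing:
  assumes l: "1 \<le> l" and L: "128 * \<kappa> * l^2 \<le> L" and C: "2 * L / l \<le> C"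
    and \<omega>: "\<omega> \<in> space M" "error 0 \<omega> \<le> 1/4" "\<omega> \<notin> crossings l"
  shows "error t \<omega> \<le> C * (l + 2 * ln (ln (real t + 9))) / (real t + L)"
proof -
  have "(real t + L) * error t \<omega> \<le> L / 4 + 8 * \<kappa> * (1/2 + (l + 2 * ln (2 * ln (real t + 9))))"
  proof (rule rate_if_no_crossing[OF l \<kappa>_pos L L_ge_1, THEN conjunct2])
    fix k s assume "real s + L \<le> horizon L k" "\<forall>r<s. error r \<omega> \<le> 1/2"
    moreover have "\<omega> \<notin> crossing (horizon L k) (level \<kappa> L l k)"
      using \<omega>(3) by (auto simp: crossings_def)
    ultimately have "\<not> level \<kappa> L l k \<le> potential \<kappa> (horizon L k) (real s + L) (error s \<omega>)"
      using \<omega>(1,2) unfolding crossing_def by blast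
    then show "potential \<kappa> (horizon L k) (real s + L) (error s \<omega>) < level \<kappa> L l k" by simp
  qed
  also have "\<dots> \<le> 2 * L / l * (l + 2 * ln (ln (real t + 9)))"
    by (intro stitched_rate_le l \<kappa>_pos L) simp
  also have "\<dots> \<le> C * (l + 2 * ln (ln (real t + 9)))"
  proof (rule mult_right_mono[OF C])
    have "1 \<le> ln (real t + 9)" using exp_le by (simp add: ln_ge_iff)
    then show "0 \<le> l + 2 * ln (ln (real t + 9))" using l by simp
  qed
  finally show ?thesis using L_ge_1 by (simp add: pos_le_divide_eq mult.commute)
qed

lemma prob_uniform_rate_ge:
  assumes L: "128 * \<kappa> * l^2 \<le> L" and C: "2 * L / l \<le> C"
    and init: "1 - p \<le> prob {\<omega>\<in>space M. error 0 \<omega> \<le> 1/4}" and p: "0 \<le> p"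
  shows "1 - p - 3 * exp (- l)
    \<le> prob {\<omega>\<in>space M. \<forall>t. error t \<omega> \<le> C * (l + 2 * ln (ln (real t + 9))) / (real t + L)}"
    (is "_ \<le> prob ?good")
proof (cases "1 \<le> l")
  case True
  let ?init = "{\<omega>\<in>space M. error 0 \<omega> \<le> 1/4}"
  have "prob ?init \<le> prob (?good \<union> crossings l)"
    using error_le_if_no_crossing[OF True L C] by (intro finite_measure_mono) auto
  also have "\<dots> \<le> prob ?good + prob (crossings l)"
    by (intro measure_Un_le) measurable
  finally show ?thesis using init prob_crossings_le[of l] by linarith
next
  case False
  have "1 / 3 \<le> exp (- 1 :: real)" using exp_le by (simp add: exp_minus field_simps)
  also have "\<dots> \<le> exp (- l)" using False by simp
  finally show ?thesis using p measure_nonneg[of M ?good] by linarith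
qed

end

lemma failure_probability_le:
  fixes \<delta> :: real
  assumes "0 < \<delta>" "\<delta> < 1"
  shows "\<delta>^3 + 3 * exp (- ln (1/\<delta>)) \<le> 2 * (exp 1 + 1) * \<delta>"
proof -
  have "exp (- ln (1/\<delta>)) = \<delta>" using assms by (simp add: ln_div)
  moreover have "\<delta>^3 \<le> \<delta>" using assms power_decreasing[of 1 3 \<delta>] by simp
  moreover have "1 * \<delta> \<le> exp 1 * \<delta>" using assms by (intro mult_right_mono) auto
  ultimately show ?thesis by (simp add: algebra_simps)
qed

theorem theorem3:
  fixes M :: "'a measure"
    and X :: "nat \<Rightarrow> 'a \<Rightarrow> real^'n"
    and v0 :: "'a \<Rightarrow> real^'n"
    and B \<rho> \<delta> Lc :: real
    and v1 :: "real^'n"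
    and \<eta> :: "nat \<Rightarrow> real"
  assumes M: "prob_space M"
    and dimp: "CARD('n) \<ge> 2"
    and meas: "\<And>t. X t \<in> borel_measurable M" "v0 \<in> borel_measurable M"
    and indep: "prob_space.indep_vars M (\<lambda>_. borel) (\<lambda>t. if t = 0 then v0 else X t) UNIV"
    and ident: "\<And>t. t \<ge> 1 \<Longrightarrow> distr M borel (X t) = distr M borel (X 1)"
    and centered: "\<And>t. t \<ge> 1 \<Longrightarrow> integral\<^sup>L M (X t) = 0"
    and bounded: "\<And>t. t \<ge> 1 \<Longrightarrow> AE \<omega> in M. norm (X t \<omega>) \<le> B"
    and gap: "lambda2 (cov_matrix M (X 1)) < lambda1 (cov_matrix M (X 1))"
    and v1: "norm v1 = 1" "cov_matrix M (X 1) *v v1 = lambda1 (cov_matrix M (X 1)) *\<^sub>R v1"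
    and rho: "\<rho> = lambda1 (cov_matrix M (X 1)) - lambda2 (cov_matrix M (X 1))"
    and unit: "AE \<omega> in M. norm (v0 \<omega>) = 1"
    and delta: "0 < \<delta>" "\<delta> < 1"
    and init: "measure M {\<omega> \<in> space M. sin2 (v0 \<omega>) v1 \<le> 1/4} \<ge> 1 - \<delta>^3"
    and Lc: "Lc = max (real_of_int \<lceil>128 * B^4 * (ln (1/\<delta>))^2 / \<rho>^2\<rceil>) 32"
    and eta: "\<And>t. \<eta> t = 2 / (\<rho> * (real t + Lc))"
  shows "measure M {\<omega> \<in> space M. \<forall>t::nat.
            sin2 (kooja \<eta> (\<lambda>s. X s \<omega>) (v0 \<omega>) t) v1
              \<le> max (252 * Lc / ln (1/\<delta>)) (1008 * B^4 / \<rho>^2)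
                 * (ln (1/\<delta>) + 2 * ln (ln (real t + 9))) / (real t + Lc)}
         \<ge> 1 - 2 * (exp 1 + 1) * \<delta>"
proof -
  have rho_eq: "\<rho> = eigengap (cov_matrix M (X 1))" by (simp add: rho eigengap_def)
  interpret prob_space M by fact
  interpret krasulina_oja M X v0 B "cov_matrix M (X 1)" v1 Lc \<eta>
  proof unfold_locales
    show "cov_matrix M (X t) = cov_matrix M (X 1)" if "1 \<le> t" for t
      by (intro cov_matrix_cong_distr meas ident that)
    show "0 < eigengap (cov_matrix M (X 1))" using gap by (simp add: eigengap_def)
    show "1 \<le> Lc" by (simp add: Lc)
    show "\<eta> t = 2 / (eigengap (cov_matrix M (X 1)) * (real t + Lc))" for t by (simp add: eta rho_eq)
  qed (fact dimp indep bounded v1)+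
  have "128 * \<kappa> * (ln (1/\<delta>))^2 \<le> Lc"
    unfolding Lc rho_eq \<kappa>_def by (intro max.coboundedI1) simp
  moreover have "2 * Lc / ln (1/\<delta>) \<le> max (252 * Lc / ln (1/\<delta>)) (1008 * B^4 / \<rho>^2)"
    using delta L_ge_1 by (intro max.coboundedI1 divide_right_mono) auto
  moreover have "1 - \<delta>^3 \<le> prob {\<omega>\<in>space M. error 0 \<omega> \<le> 1/4}"
    using init by (simp add: error_def iterate_def)
  moreover have "0 \<le> \<delta>^3" using delta by simp
  ultimately have "1 - \<delta>^3 - 3 * exp (- ln (1/\<delta>)) \<le> prob {\<omega>\<in>space M. \<forall>t. error t \<omega>
      \<le> max (252 * Lc / ln (1/\<delta>)) (1008 * B^4 / \<rho>^2)
         * (ln (1/\<delta>) + 2 * ln (ln (real t + 9))) / (real t + Lc)}"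
    by (rule prob_uniform_rate_ge)
  then show ?thesis
    using failure_probability_le[OF delta] unfolding error_def iterate_def by linarith
qed

end
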